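(* Let $\Gamma,\Gamma',F$ be finite graphs, let $f:\Gamma\to\Gamma'$ be a morphism of graphs, let $\phi$ be an $F$-voltage function on $\Gamma'$, and consider the $F$-graph bundle $(\Gamma'\times_\phi F,p,\Gamma')$ with $p(v,a)=v$. Then the adjacency matrix of the total space $\Gamma\times_{f^*\phi}F$ of the pullback bundle $(\Gamma\times_{f^*\phi}F,f^*p,\Gamma)$ is $$A_{\Gamma\times_{f^*\phi}F}=\sum_{\psi\in\mathrm{Aut}(F)}[A_\Gamma\circ B_{f,\psi}]\otimes\mathrm{perm}(\psi)+I_{|V_\Gamma|}\otimes A_F,$$ where $$B_{f,\psi}=\begin{cases}M_f^T\,(I_{|V_{\Gamma'}|}+A_{\Gamma'}(\psi))\,M_f & \text{if }\psi=\mathrm{id}_F,\\ M_f^T\,A_{\Gamma'}(\psi)\,M_f&\text{otherwise.}\end{cases}$$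
   Context: Graphs are simple and undirected: $\Gamma=(V_\Gamma,E_\Gamma)$ with $E_\Gamma$ a set of unordered pairs of distinct vertices; $v\sim w$ means $\{v,w\}\in E_\Gamma$. A morphism of graphs $f:\Gamma\to\Gamma'$ is a function $V_\Gamma\to V_{\Gamma'}$ such that $v\sim w$ implies $f(v)\sim f(w)$ or $f(v)=f(w)$. $\mathrm{Aut}(F)$ is the group of automorphisms of $F$ (bijections of $V_F$ preserving adjacency in both directions). $\vec E_\Gamma=\{(v,w): \{v,w\}\in E_\Gamma\}$ is the set of oriented edges. An $F$-voltage function on $\Gamma'$ is a function $\phi:\vec E_{\Gamma'}\to\mathrm{Aut}(F)$ with $\phi(w,v)=\phi(v,w)^{-1}$. The graph $\Gamma'\times_\phi F$ has vertex set $V_{\Gamma'}\times V_F$, with $(v_1,a_1)\sim(v_2,a_2)$ iff either $v_1\sim v_2$ and $a_2=\phi(v_1,v_2)(a_1)$, or $v_1=v_2$ and $a_1\sim a_2$. The pullback voltage function $f^*\phi:\vec E_\Gamma\to\mathrm{Aut}(F)$ is $f^*\phi(v,w)=\mathrm{id}_F$ if $f(v)=f(w)$, and $f^*\phi(v,w)=\phi(f(v),f(w))$ otherwise. The pullback along $f$ of $(\Gamma'\times_\phi F,p,\Gamma')$ is identified with $(\Gamma\times_{f^*\phi}F,f^*p,\Gamma)$, where $f^*p(v,a)=v$. Matrices. Fix orders on $V_\Gamma,V_{\Gamma'},V_F$, and the lexicographic order on products of vertex sets. $A_\Gamma$ is the $0/1$ adjacency matrix. $A_{\Gamma'}(\psi)$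 is the $V_{\Gamma'}\times V_{\Gamma'}$ matrix with $(i,j)$-entry $1$ if $i\sim j$ and $\phi(i,j)=\psi$, and $0$ otherwise. $\mathrm{perm}(\psi)$ is the permutation matrix with $(a,b)$-entry $1$ if $b=\psi(a)$ and $0$ otherwise. $M_f$ is the $|V_{\Gamma'}|\times|V_\Gamma|$ matrix with $(w,v)$-entry $1$ if $f(v)=w$ and $0$ otherwise. $I_n$ is the identity matrix of size $n$, $\otimes$ the Kronecker product ($A\otimes B$ has blocks $a_{ij}B$), and $\circ$ (between matrices) the Hadamard (entrywise) product. *)

theory Defs
  imports "Jordan_Normal_Form.Matrix" "HOL-Combinatorics.Permutations"
begin

section \<open>Graphs, morphisms and automorphisms\<close>

record 'a graph =
  verts :: "'a set"
  edges :: "'a set set"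

definition simple_graph :: "'a graph \<Rightarrow> bool" where
  "simple_graph G \<longleftrightarrow> (\<forall>e \<in> edges G. \<exists>v \<in> verts G. \<exists>w \<in> verts G. v \<noteq> w \<and> e = {v, w})"

definition finite_simple_graph :: "'a graph \<Rightarrow> bool" where
  "finite_simple_graph G \<longleftrightarrow> simple_graph G \<and> finite (verts G)"

definition adj :: "'a graph \<Rightarrow> 'a \<Rightarrow> 'a \<Rightarrow> bool" where
  "adj G v w \<longleftrightarrow> {v, w} \<in> edges G"

definition graph_morphism :: "'a graph \<Rightarrow> 'b graph \<Rightarrow> ('a \<Rightarrow> 'b) \<Rightarrow> bool" where
  "graph_morphism G G' f \<longleftrightarrow> f ` verts G \<subseteq> verts G' \<and>
     (\<forall>v \<in> verts G. \<forall>w \<in> verts G. adj G v w \<longrightarrow> adj G' (f v) (f w) \<or> f v = f w)"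

text \<open>
  An automorphism is represented by its extension by the identity outside the vertex set
  (this is part of \<^const>\<open>permutes\<close>), so distinct automorphisms are distinct functions, the
  identity automorphism is \<^const>\<open>id\<close>, and the group inverse is \<^term>\<open>Hilbert_Choice.inv\<close>.
\<close>

definition Aut :: "'a graph \<Rightarrow> ('a \<Rightarrow> 'a) set" where
  "Aut F = {\<psi>. \<psi> permutes verts F \<and>
     (\<forall>a \<in> verts F. \<forall>b \<in> verts F. adj F a b \<longleftrightarrow> adj F (\<psi> a) (\<psi> b))}"

section \<open>Voltage functions and graph bundles\<close>

definition oriented_edges :: "'a graph \<Rightarrow> ('a \<times> 'a) set" where
  "oriented_edges G = {(v, w). {v, w} \<in> edges G}"

text \<open>The values of a voltage function off the oriented edges are irrelevant.\<close>

definition voltage_function :: "'b graph \<Rightarrow> 'f graph \<Rightarrow> ('b \<times> 'b \<Rightarrow> 'f \<Rightarrow> 'f) \<Rightarrow> bool" where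
  "voltage_function G F \<phi> \<longleftrightarrow> (\<forall>(v, w) \<in> oriented_edges G.
     \<phi> (v, w) \<in> Aut F \<and> \<phi> (w, v) = Hilbert_Choice.inv (\<phi> (v, w)))"

definition voltage_product :: "'b graph \<Rightarrow> ('b \<times> 'b \<Rightarrow> 'f \<Rightarrow> 'f) \<Rightarrow> 'f graph \<Rightarrow> ('b \<times> 'f) graph" where
  "voltage_product G \<phi> F =
     \<lparr> verts = verts G \<times> verts F,
       edges = {{(v1, a1), (v2, a2)} | v1 a1 v2 a2.
         v1 \<in> verts G \<and> a1 \<in> verts F \<and> v2 \<in> verts G \<and> a2 \<in> verts F \<and>
         (adj G v1 v2 \<and> a2 = \<phi> (v1, v2) a1 \<or> v1 = v2 \<and> adj F a1 a2)} \<rparr>"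

definition pullback_voltage :: "('a \<Rightarrow> 'b) \<Rightarrow> ('b \<times> 'b \<Rightarrow> 'f \<Rightarrow> 'f) \<Rightarrow> ('a \<times> 'a \<Rightarrow> 'f \<Rightarrow> 'f)" where
  "pullback_voltage f \<phi> = (\<lambda>(v, w). if f v = f w then id else \<phi> (f v, f w))"

record ('t, 'b) graph_bundle =
  total_space :: "'t graph"
  proj :: "'t \<Rightarrow> 'b"
  base :: "'b graph"

definition voltage_bundle ::
  "'b graph \<Rightarrow> ('b \<times> 'b \<Rightarrow> 'f \<Rightarrow> 'f) \<Rightarrow> 'f graph \<Rightarrow> ('b \<times> 'f, 'b) graph_bundle" where
  "voltage_bundle G \<phi> F = \<lparr> total_space = voltage_product G \<phi> F, proj = fst, base = G \<rparr>"

text \<open>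
  The pullback along \<open>f\<close> of the bundle given by \<open>\<phi>\<close>, in its identification with the bundle
  over \<open>G\<close> given by the pullback voltage.
\<close>

definition pullback_bundle ::
  "'a graph \<Rightarrow> ('a \<Rightarrow> 'b) \<Rightarrow> ('b \<times> 'b \<Rightarrow> 'f \<Rightarrow> 'f) \<Rightarrow> 'f graph \<Rightarrow> ('a \<times> 'f, 'a) graph_bundle" where
  "pullback_bundle G f \<phi> F = voltage_bundle G (pullback_voltage f \<phi>) F"

text \<open>
  Edges of \<^const>\<open>voltage_product\<close> are unordered pairs, so the defining condition, which is
  not visibly symmetric, describes adjacency only because \<open>\<phi> (w, v) = inv (\<phi> (v, w))\<close>.
\<close>

lemma adj_sym: "adj G v w \<longleftrightarrow> adj G w v"
  by (simp add: adj_def insert_commute)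

lemma adj_voltage_product:
  assumes "voltage_function G F \<phi>"
    and "v1 \<in> verts G" "a1 \<in> verts F" "v2 \<in> verts G" "a2 \<in> verts F"
  shows "adj (voltage_product G \<phi> F) (v1, a1) (v2, a2) \<longleftrightarrow>
    adj G v1 v2 \<and> a2 = \<phi> (v1, v2) a1 \<or> v1 = v2 \<and> adj F a1 a2"
    (is "?A \<longleftrightarrow> ?P v1 a1 v2 a2")
proof -
  have sym: "?P v2 a2 v1 a1 \<Longrightarrow> ?P v1 a1 v2 a2"
  proof -
    assume h: "?P v2 a2 v1 a1"
    have "a2 = \<phi> (v1, v2) a1" if e: "adj G v2 v1" and a: "a1 = \<phi> (v2, v1) a2"
    proof -
      from e assms(1) have "\<phi> (v2, v1) permutes verts F" "\<phi> (v1, v2) = Hilbert_Choice.inv (\<phi> (v2, v1))"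
        by (auto simp: voltage_function_def oriented_edges_def adj_def Aut_def)
      then show ?thesis by (simp add: a permutes_inverses(2))
    qed
    with h show ?thesis by (auto simp: adj_sym)
  qed
  have "?A \<longleftrightarrow> ?P v1 a1 v2 a2 \<or> ?P v2 a2 v1 a1"
    using assms(2-) by (auto simp: adj_def voltage_product_def doubleton_eq_iff)
  with sym show ?thesis by blast
qed

section \<open>Matrices\<close>

text \<open>
  An order on a finite vertex set is an enumeration without repetitions. For orders
  \<open>xs\<close> and \<open>ys\<close>, the list \<^term>\<open>List.product xs ys\<close> is the lexicographic order on the product.
\<close>

definition vertex_order :: "'a graph \<Rightarrow> 'a list \<Rightarrow> bool" where
  "vertex_order G vs \<longleftrightarrow> distinct vs \<and> set vs = verts G"

definition adj_mat :: "'a graph \<Rightarrow> 'a list \<Rightarrow> real mat" where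
  "adj_mat G vs = mat (length vs) (length vs) (\<lambda>(i, j). if adj G (vs ! i) (vs ! j) then 1 else 0)"

definition voltage_adj_mat ::
  "'b graph \<Rightarrow> 'b list \<Rightarrow> ('b \<times> 'b \<Rightarrow> 'f \<Rightarrow> 'f) \<Rightarrow> ('f \<Rightarrow> 'f) \<Rightarrow> real mat" where
  "voltage_adj_mat G ws \<phi> \<psi> = mat (length ws) (length ws)
     (\<lambda>(i, j). if adj G (ws ! i) (ws ! j) \<and> \<phi> (ws ! i, ws ! j) = \<psi> then 1 else 0)"

definition perm_mat :: "'f list \<Rightarrow> ('f \<Rightarrow> 'f) \<Rightarrow> real mat" where
  "perm_mat as \<psi> = mat (length as) (length as) (\<lambda>(i, j). if as ! j = \<psi> (as ! i) then 1 else 0)"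

definition morphism_mat :: "'b list \<Rightarrow> 'a list \<Rightarrow> ('a \<Rightarrow> 'b) \<Rightarrow> real mat" where
  "morphism_mat ws vs f = mat (length ws) (length vs) (\<lambda>(i, j). if f (vs ! j) = ws ! i then 1 else 0)"

definition kronecker_prod :: "'r::times mat \<Rightarrow> 'r mat \<Rightarrow> 'r mat" (infixl "\<otimes>\<^sub>K" 70) where
  "A \<otimes>\<^sub>K B = mat (dim_row A * dim_row B) (dim_col A * dim_col B)
     (\<lambda>(i, j). A $$ (i div dim_row B, j div dim_col B) * B $$ (i mod dim_row B, j mod dim_col B))"

text \<open>Meaningful for matrices of equal dimensions only.\<close>

definition hadamard_prod :: "'r::times mat \<Rightarrow> 'r mat \<Rightarrow> 'r mat" (infixl "\<circ>\<^sub>H" 70) where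
  "A \<circ>\<^sub>H B = mat (dim_row A) (dim_col A) (\<lambda>(i, j). A $$ (i, j) * B $$ (i, j))"

definition B_mat ::
  "'b graph \<Rightarrow> 'b list \<Rightarrow> 'a list \<Rightarrow> ('b \<times> 'b \<Rightarrow> 'f \<Rightarrow> 'f) \<Rightarrow> ('a \<Rightarrow> 'b) \<Rightarrow> ('f \<Rightarrow> 'f) \<Rightarrow> real mat" where
  "B_mat G' ws vs \<phi> f \<psi> =
     (if \<psi> = id
      then transpose_mat (morphism_mat ws vs f)
             * (1\<^sub>m (card (verts G')) + voltage_adj_mat G' ws \<phi> \<psi>) * morphism_mat ws vs f
      else transpose_mat (morphism_mat ws vs f)
             * voltage_adj_mat G' ws \<phi> \<psi> * morphism_mat ws vs f)"

text \<open>Matrices of all sizes share one type, which is no \<^class>\<open>comm_monoid_add\<close>, so the size is fixed explicitly.\<close>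

abbreviation mat_sum :: "nat \<Rightarrow> ('i \<Rightarrow> real mat) \<Rightarrow> 'i set \<Rightarrow> real mat" where
  "mat_sum n \<equiv> finsum (module_mat TYPE(real) n n)"

end

theory Submission
  imports Defs
begin

text \<open>
  Both sides are compared entry by entry. Over an edge \<open>v \<sim> w\<close> of \<open>\<Gamma>\<close>, exactly one
  matrix \<open>B\<^bsub>f,\<psi>\<^esub>\<close> has a nonzero \<open>(v, w)\<close>-entry, namely the one with \<open>\<psi>\<close> equal to the pullback voltage
  of \<open>(v, w)\<close>: if \<open>f\<close> collapses the edge, the entry 1 comes from the identity matrix (there are no
  loops), and otherwise from the voltage adjacency matrix.
\<close>

lemma finsum_module_mat_closed:
  assumes "g \<in> A \<rightarrow> carrier_mat n m"
  shows "finsum (module_mat TYPE('r::comm_ring_1) n m) g A \<in> carrier_mat n m"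
proof -
  interpret abelian_group "module_mat TYPE('r) n m"
    by (rule abelian_group_mat)
  show ?thesis
    using finsum_closed[of g A] assms by (simp add: module_mat_simps)
qed

text \<open>Matrix addition is entrywise, so induction on \<open>A\<close> reduces the module sum to
  an ordinary sum of entries. There a single nonzero summand can be picked out.\<close>

lemma index_finsum_module_mat:
  assumes "finite A" "g \<in> A \<rightarrow> carrier_mat n m" "i < n" "j < m"
  shows "finsum (module_mat TYPE('r::comm_ring_1) n m) g A $$ (i, j) = (\<Sum>x\<in>A. g x $$ (i, j))"
proof -
  interpret abelian_group "module_mat TYPE('r) n m"
    by (rule abelian_group_mat)
  show ?thesis
    using assms(1,2)
  proof (induction A)
    case empty
    then show ?case using assms(3,4) by (simp add: module_mat_simps)
  next
    case (insert x A)
    have "finsum (module_mat TYPE('r) n m) g (insert x A) = g x + finsum (module_mat TYPE('r) n m) g A"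
      using finsum_insert[of A x g] insert.hyps insert.prems by (simp add: module_mat_simps)
    moreover have "finsum (module_mat TYPE('r) n m) g A \<in> carrier_mat n m"
      using insert.prems by (intro finsum_module_mat_closed) auto
    ultimately show ?case using insert assms(3,4) by auto
  qed
qed

lemma finite_Aut: "finite (verts F) \<Longrightarrow> finite (Aut F)"
  by (rule finite_subset[OF _ finite_permutations]) (auto simp: Aut_def)

lemma id_in_Aut: "id \<in> Aut F"
  by (simp add: Aut_def permutes_id)

lemma not_adj_self: "simple_graph G \<Longrightarrow> \<not> adj G v v"
  by (fastforce simp: simple_graph_def adj_def)

lemma adj_verts:
  assumes "simple_graph G" "adj G v w"
  shows "v \<in> verts G" "w \<in> verts G"
  using assms by (auto simp: simple_graph_def adj_def doubleton_eq_iff dest!: bspec)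

lemma voltage_function_in_Aut:
  "voltage_function G F \<phi> \<Longrightarrow> adj G v w \<Longrightarrow> \<phi> (v, w) \<in> Aut F"
  by (auto simp: voltage_function_def oriented_edges_def adj_def)

text \<open>On a collapsed edge the value is \<open>id\<close>, its own inverse; on any other edge
  the morphism property makes the image an edge of \<open>G'\<close>, where \<phi> has the required
  symmetry. This makes \<open>adj_voltage_product\<close> available for the pullback.\<close>

lemma pullback_voltage_function:
  assumes "simple_graph G" "graph_morphism G G' f" "voltage_function G' F \<phi>"
  shows "voltage_function G F (pullback_voltage f \<phi>)"
  unfolding voltage_function_def
proof clarify
  fix v w assume "(v, w) \<in> oriented_edges G"
  then have e: "adj G v w" by (simp add: oriented_edges_def adj_def)
  with assms(1,2) adj_verts[OF assms(1) e] have "adj G' (f v) (f w) \<or> f v = f w"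
    by (auto simp: graph_morphism_def)
  with assms(3) show "pullback_voltage f \<phi> (v, w) \<in> Aut F \<and>
      pullback_voltage f \<phi> (w, v) = Hilbert_Choice.inv (pullback_voltage f \<phi> (v, w))"
    by (auto simp: pullback_voltage_def id_in_Aut voltage_function_def oriented_edges_def adj_def)
qed

text \<open>Since \<open>ws\<close> has no repetitions, each column of \<open>morphism_mat\<close>
  is a standard unit vector, at the position of the image vertex. Multiplying by it on both sides
  therefore selects one entry of \<open>X\<close>.\<close>

lemma morphism_mat_congruence_index:
  assumes X: "X \<in> carrier_mat (length ws) (length ws)" and "distinct ws"
    and i: "i < length vs" and j: "j < length vs"
    and p: "p < length ws" "f (vs ! i) = ws ! p" and q: "q < length ws" "f (vs ! j) = ws ! q"
  shows "(transpose_mat (morphism_mat ws vs f) * X * morphism_mat ws vs f) $$ (i, j) = X $$ (p, q)"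
proof -
  have col: "morphism_mat ws vs f $$ (k, l) = (if k = r then 1 else 0)"
    if "k < length ws" "l < length vs" "r < length ws" "f (vs ! l) = ws ! r" for k l r
    using that \<open>distinct ws\<close> by (auto simp: morphism_mat_def nth_eq_iff_index_eq)
  have dims: "dim_row (morphism_mat ws vs f) = length ws" "dim_col (morphism_mat ws vs f) = length vs"
    by (simp_all add: morphism_mat_def)
  have row: "(transpose_mat (morphism_mat ws vs f) * X) $$ (i, k) = X $$ (p, k)"
    if "k < length ws" for k
    using X i p that
    by (simp add: scalar_prod_def dims col[OF _ i p] if_distrib[of "\<lambda>x. x * _"] cong: if_cong)
  \<comment> \<open>Only the outer product, at column \<open>j\<close>, is expanded: the general
    product rule would also unfold the inner product, which has to stay intact for
    \<open>row\<close>.\<close>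
  show ?thesis
    using X i j q
    by (simp add: scalar_prod_def dims col[OF _ j q] if_distrib[of "\<lambda>x. _ * x"] row
        index_mult_mat(1)[of i _ j] cong: if_cong del: index_mult_mat(1))
qed

text \<open>Hypothesis \<open>e\<close> is what a morphism provides on an edge. For distinct
  non-adjacent images the entry is 0 for every \<psi>, although the pullback voltage still takes
  some value there.\<close>

lemma B_mat_index:
  assumes "finite_simple_graph G'" "vertex_order G' ws" "f ` set vs \<subseteq> verts G'"
    and i: "i < length vs" and j: "j < length vs"
    and e: "adj G' (f (vs ! i)) (f (vs ! j)) \<or> f (vs ! i) = f (vs ! j)"
  shows "B_mat G' ws vs \<phi> f \<psi> $$ (i, j) =
    (if pullback_voltage f \<phi> (vs ! i, vs ! j) = \<psi> then 1 else 0)"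
proof -
  have ws: "distinct ws" "set ws = verts G'" "card (verts G') = length ws"
    using assms(2) distinct_card[of ws] by (auto simp: vertex_order_def)
  have "f (vs ! i) \<in> set ws" "f (vs ! j) \<in> set ws"
    using assms(3) i j ws(2) by auto
  then obtain p q where p: "p < length ws" "f (vs ! i) = ws ! p"
    and q: "q < length ws" "f (vs ! j) = ws ! q"
    by (metis in_set_conv_nth)
  have pq: "p = q \<longleftrightarrow> f (vs ! i) = f (vs ! j)"
    using p q ws(1) by (simp add: nth_eq_iff_index_eq)
  note M = morphism_mat_congruence_index[OF _ ws(1) i j p q]
  have loop: "\<not> adj G' (ws ! q) (ws ! q)"
    using assms(1) by (simp add: finite_simple_graph_def not_adj_self)
  have V: "voltage_adj_mat G' ws \<phi> \<chi> \<in> carrier_mat (length ws) (length ws)" for \<chi>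
    by (simp add: voltage_adj_mat_def)
  \<comment> \<open>Both branches of \<open>B_mat\<close> merge into one formula, in which the
    identity matrix contributes only for \<open>\<psi> = id\<close> and only on the
    diagonal.\<close>
  have "B_mat G' ws vs \<phi> f \<psi> $$ (i, j) =
      (if \<psi> = id \<and> p = q then 1 else 0) + voltage_adj_mat G' ws \<phi> \<psi> $$ (p, q)"
    using V[of \<psi>] V[of id] p(1) q(1) by (simp add: B_mat_def ws(3) M)
  then show ?thesis
    using p q e pq loop by (auto simp: voltage_adj_mat_def pullback_voltage_def)
qed

theorem theorem3p12:
  fixes \<Gamma> :: "'a graph" and \<Gamma>' :: "'b graph" and F :: "'f graph"
    and f :: "'a \<Rightarrow> 'b" and \<phi> :: "'b \<times> 'b \<Rightarrow> 'f \<Rightarrow> 'f"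
    and vs :: "'a list" and ws :: "'b list" and as :: "'f list"
  assumes "finite_simple_graph \<Gamma>" and "finite_simple_graph \<Gamma>'" and "finite_simple_graph F"
    and "vertex_order \<Gamma> vs" and "vertex_order \<Gamma>' ws" and "vertex_order F as"
    and "graph_morphism \<Gamma> \<Gamma>' f"
    and "voltage_function \<Gamma>' F \<phi>"
  shows "adj_mat (total_space (pullback_bundle \<Gamma> f \<phi> F)) (List.product vs as) =
    mat_sum (card (verts \<Gamma>) * card (verts F))
      (\<lambda>\<psi>. (adj_mat \<Gamma> vs \<circ>\<^sub>H B_mat \<Gamma>' ws vs \<phi> f \<psi>) \<otimes>\<^sub>K perm_mat as \<psi>) (Aut F)
    + 1\<^sub>m (card (verts \<Gamma>)) \<otimes>\<^sub>K adj_mat F as"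
proof -
  let ?n = "length vs" and ?m = "length as" and ?\<phi> = "pullback_voltage f \<phi>"
  let ?g = "\<lambda>\<psi>. (adj_mat \<Gamma> vs \<circ>\<^sub>H B_mat \<Gamma>' ws vs \<phi> f \<psi>) \<otimes>\<^sub>K perm_mat as \<psi>"
  have vs: "set vs = verts \<Gamma>" "distinct vs" "card (verts \<Gamma>) = ?n"
    and as: "set as = verts F" "card (verts F) = ?m"
    using assms(4,6) distinct_card[of vs] distinct_card[of as] by (auto simp: vertex_order_def)
  have simple: "simple_graph \<Gamma>" and fin: "finite (Aut F)"
    using assms(1,3) by (simp_all add: finite_simple_graph_def finite_Aut)
  have volt: "voltage_function \<Gamma> F ?\<phi>"
    by (rule pullback_voltage_function[OF simple assms(7,8)])
  have g: "?g \<in> Aut F \<rightarrow> carrier_mat (?n * ?m) (?n * ?m)"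
    by (auto simp: kronecker_prod_def hadamard_prod_def adj_mat_def perm_mat_def)
  have "adj_mat (total_space (pullback_bundle \<Gamma> f \<phi> F)) (List.product vs as) =
    mat_sum (?n * ?m) ?g (Aut F) + 1\<^sub>m ?n \<otimes>\<^sub>K adj_mat F as" (is "?L = ?R")
  proof (rule eq_matI)
    show "dim_row ?L = dim_row ?R" "dim_col ?L = dim_col ?R"
      by (simp_all add: adj_mat_def kronecker_prod_def)
    fix i j assume "i < dim_row ?R" "j < dim_col ?R"
    then have i: "i < ?n * ?m" and j: "j < ?n * ?m"
      by (simp_all add: adj_mat_def kronecker_prod_def)
    \<comment> \<open>In lexicographic order, position \<open>i\<close> carries the pair at
      positions \<open>i div ?m\<close> and \<open>i mod ?m\<close>, which is also how the Kronecker
      product splits its indices.\<close>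
    define i1 i2 j1 j2 where ij: "i1 = i div ?m" "i2 = i mod ?m" "j1 = j div ?m" "j2 = j mod ?m"
    have m: "?m > 0" using i by (cases ?m) auto
    have lt: "i1 < ?n" "i2 < ?m" "j1 < ?n" "j2 < ?m"
      using i j m by (simp_all add: ij less_mult_imp_div_less)
    let ?v = "vs ! i1" and ?w = "vs ! j1" and ?a = "as ! i2" and ?b = "as ! j2"
    have mem: "?v \<in> verts \<Gamma>" "?w \<in> verts \<Gamma>" "?a \<in> verts F" "?b \<in> verts F"
      using lt vs(1) as(1) by auto
    have L: "?L $$ (i, j) = (if adj \<Gamma> ?v ?w \<and> ?b = ?\<phi> (?v, ?w) ?a \<or> ?v = ?w \<and> adj F ?a ?b then 1 else 0)"
      using i j mem adj_voltage_product[OF volt mem(1,3,2,4)]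
      by (simp add: adj_mat_def pullback_bundle_def voltage_bundle_def product_nth flip: ij)
    \<comment> \<open>The test on \<psi> stands outermost and the inner value does not mention
      \<psi>, so the sum over \<open>Aut F\<close> collapses to one term.\<close>
    have entry: "?g \<psi> $$ (i, j) =
        (if \<psi> = ?\<phi> (?v, ?w) then if adj \<Gamma> ?v ?w \<and> ?b = ?\<phi> (?v, ?w) ?a then 1 else 0 else 0)" for \<psi>
    proof (cases "adj \<Gamma> ?v ?w")
      case True
      then have "adj \<Gamma>' (f ?v) (f ?w) \<or> f ?v = f ?w"
        using assms(7) mem by (auto simp: graph_morphism_def)
      moreover have "f ` set vs \<subseteq> verts \<Gamma>'"
        using assms(7) by (simp add: graph_morphism_def vs(1))
      ultimately show ?thesis
        using i j lt True B_mat_index[OF assms(2,5) _ lt(1,3), of f \<phi> \<psi>]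
        by (auto simp: kronecker_prod_def hadamard_prod_def adj_mat_def perm_mat_def simp flip: ij)
    next
      case False
      then show ?thesis
        using i j lt
        by (simp add: kronecker_prod_def hadamard_prod_def adj_mat_def perm_mat_def flip: ij)
    qed
    have "mat_sum (?n * ?m) ?g (Aut F) $$ (i, j) =
        (\<Sum>\<psi>\<in>Aut F. if \<psi> = ?\<phi> (?v, ?w) then if adj \<Gamma> ?v ?w \<and> ?b = ?\<phi> (?v, ?w) ?a then 1 else 0 else 0)"
      by (simp only: index_finsum_module_mat[OF fin g i j] entry)
    \<comment> \<open>On an edge the selected voltage lies in \<open>Aut F\<close>, so its term does
      occur in the sum; off the edges every term is 0.\<close>
    also have "\<dots> = (if adj \<Gamma> ?v ?w \<and> ?b = ?\<phi> (?v, ?w) ?a then 1 else 0)"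
      using fin voltage_function_in_Aut[OF volt] by auto
    finally have S: "mat_sum (?n * ?m) ?g (Aut F) $$ (i, j) = \<dots>" .
    have "(1\<^sub>m ?n \<otimes>\<^sub>K adj_mat F as) $$ (i, j) = (if ?v = ?w \<and> adj F ?a ?b then 1 else 0)"
      using i j lt vs(2)
      by (simp add: kronecker_prod_def adj_mat_def nth_eq_iff_index_eq flip: ij)
    then have "?R $$ (i, j) = (if adj \<Gamma> ?v ?w \<and> ?b = ?\<phi> (?v, ?w) ?a then 1 else 0) +
        (if ?v = ?w \<and> adj F ?a ?b then 1 else 0)"
      using i j S by (simp add: kronecker_prod_def adj_mat_def)
    \<comment> \<open>The two indicators add up to that of the disjunction because they exclude each
      other: \<open>?v = ?w\<close> together with adjacency would be a loop.\<close>
    then show "?L $$ (i, j) = ?R $$ (i, j)"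
      using not_adj_self[OF simple] by (auto simp: L)
  qed
  then show ?thesis by (simp add: vs(3) as(2))
qed

end
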